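(* Let $C$ be a bounded convex subset of a Banach space $X$, let $\mathcal U$ be a countably incomplete ultrafilter on an infinite set $I$, and let $x\in C$. The following assertions are equivalent: (i) $\mathcal J(x)$ is a strongly extreme point of $C_{\mathcal U}$; (ii) $\mathcal J(x)$ is an extreme point of $C_{\mathcal U}$; (iii) $x$ is a strongly extreme point of $C$.
   Context: Banach spaces are real. A free (i.e. non-principal) ultrafilter $\mathcal U$ on a set $I$ is countably incomplete if there is a sequence $(I_n)_{n\in\mathbb N}\subset\mathcal U$ with $\bigcap_n I_n=\emptyset$. For a free ultrafilter $\mathcal U$ on an infinite set $I$, the ultrapower is $X_{\mathcal U}=\ell_\infty(I,X)/\{(x_i)_{i\in I}:\lim_{\mathcal U}\|x_i\|=0\}$; the class of $(x_i)_{i\in I}$ is written $(x_i)_{\mathcal U}$ and has norm $\lim_{\mathcal U}\|x_i\|$. For bounded $A\subset X$, $A_{\mathcal U}=\{(x_i)_{\mathcal U}: x_i\in A\ \forall i\in I\}$. The canonical isometric embedding $\mathcal J:X\to X_{\mathcal U}$ sends $x$ to the class of the constant family $(x)_{i\in I}$. For a bounded convex set $D$ in a Banach space, a point $x\in D$ is strongly extreme if for all sequences $(y_n),(z_n)$ in $D$ with $\|x-\frac{y_n+z_n}{2}\|\to0$ one has $\|y_n-z_n\|\to 0$. *)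

theory Defs
  imports "HOL-Analysis.Analysis"
begin

section \<open>Ultrafilters\<close>

text \<open>
  An ultrafilter on the index type is represented as a library filter, with
  \<open>eventually (\<lambda>i. i \<in> A) U\<close> meaning that the set \<open>A\<close> belongs to the ultrafilter, so that
  limits along it are the library's limits. Note that \<open>bot\<close> is the improper filter.
\<close>

definition ultrafilter :: "'i filter \<Rightarrow> bool" where
  "ultrafilter U \<longleftrightarrow> U \<noteq> bot \<and>
     (\<forall>A. eventually (\<lambda>i. i \<in> A) U \<or> eventually (\<lambda>i. i \<in> - A) U)"

definition free_ultrafilter :: "'i filter \<Rightarrow> bool" where
  "free_ultrafilter U \<longleftrightarrow> ultrafilter U \<and> (\<forall>i. U \<noteq> principal {i})"

definition countably_incomplete_ultrafilter :: "'i filter \<Rightarrow> bool" where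
  "countably_incomplete_ultrafilter U \<longleftrightarrow> free_ultrafilter U \<and>
     (\<exists>J :: nat \<Rightarrow> 'i set. (\<forall>n. eventually (\<lambda>i. i \<in> J n) U) \<and> (\<Inter>n. J n) = {})"


section \<open>Normed spaces with explicit operations\<close>

text \<open>
  The ultrapower depends on the ultrafilter, which is a term, so it cannot be a type.
  The notions of extreme and strongly extreme point are therefore stated for normed spaces
  given by their operations, and serve both for the ultrapower and (through \<open>type_space\<close>)
  for the original Banach space.
\<close>

record 'v normed_struct =
  points :: "'v set"
  vzero :: 'v
  vadd :: "'v \<Rightarrow> 'v \<Rightarrow> 'v"
  vscale :: "real \<Rightarrow> 'v \<Rightarrow> 'v"
  vnorm :: "'v \<Rightarrow> real"

definition vdiff :: "'v normed_struct \<Rightarrow> 'v \<Rightarrow> 'v \<Rightarrow> 'v" where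
  "vdiff E u v = vadd E u (vscale E (- 1) v)"

definition type_space :: "'a::real_normed_vector normed_struct" where
  "type_space = \<lparr>points = UNIV, vzero = 0, vadd = (+), vscale = scaleR, vnorm = norm\<rparr>"

definition extreme_point :: "'v normed_struct \<Rightarrow> 'v set \<Rightarrow> 'v \<Rightarrow> bool" where
  "extreme_point E D x \<longleftrightarrow> x \<in> D \<and>
     (\<forall>a\<in>D. \<forall>b\<in>D. \<not> (a \<noteq> b \<and>
        (\<exists>t::real. 0 < t \<and> t < 1 \<and> x = vadd E (vscale E (1 - t) a) (vscale E t b))))"

definition strongly_extreme_point :: "'v normed_struct \<Rightarrow> 'v set \<Rightarrow> 'v \<Rightarrow> bool" where
  "strongly_extreme_point E D x \<longleftrightarrow> x \<in> D \<and>
     (\<forall>y z :: nat \<Rightarrow> 'v. (\<forall>n. y n \<in> D) \<and> (\<forall>n. z n \<in> D) \<and>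
        (\<lambda>n. vnorm E (vdiff E x (vscale E (1/2) (vadd E (y n) (z n))))) \<longlonglongrightarrow> 0 \<longrightarrow>
        (\<lambda>n. vnorm E (vdiff E (y n) (z n))) \<longlonglongrightarrow> 0)"

lemma extreme_point_type_space:
  "extreme_point type_space D x \<longleftrightarrow> x extreme_point_of D"
  unfolding extreme_point_def extreme_point_of_def type_space_def
  by (auto simp: in_segment)

lemma strongly_extreme_point_type_space:
  "strongly_extreme_point type_space D x \<longleftrightarrow> x \<in> D \<and>
     (\<forall>y z. (\<forall>n. y n \<in> D) \<and> (\<forall>n. z n \<in> D) \<and>
        (\<lambda>n. norm (x - (1/2) *\<^sub>R (y n + z n))) \<longlonglongrightarrow> 0 \<longrightarrow>
        (\<lambda>n. norm (y n - z n)) \<longlonglongrightarrow> 0)"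
  unfolding strongly_extreme_point_def vdiff_def type_space_def by simp


section \<open>The ultrapower of a normed space\<close>

definition linf :: "('i \<Rightarrow> 'a::real_normed_vector) set" where
  "linf = {x. bounded (range x)}"

definition ultra_rel ::
  "'i filter \<Rightarrow> (('i \<Rightarrow> 'a::real_normed_vector) \<times> ('i \<Rightarrow> 'a)) set" where
  "ultra_rel U = {(x, y). x \<in> linf \<and> y \<in> linf \<and> ((\<lambda>i. norm (x i - y i)) \<longlongrightarrow> 0) U}"

definition ultra_class ::
  "'i filter \<Rightarrow> ('i \<Rightarrow> 'a::real_normed_vector) \<Rightarrow> ('i \<Rightarrow> 'a) set" where
  "ultra_class U x = ultra_rel U `` {x}"

text \<open>
  The operations act on chosen representatives; the lemmas \<open>ultrapower_add\<close>,
  \<open>ultrapower_scale\<close> and \<open>ultrapower_norm\<close> below show that the choice is immaterial.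
\<close>

definition rep :: "('i \<Rightarrow> 'a) set \<Rightarrow> ('i \<Rightarrow> 'a)" where
  "rep \<xi> = (SOME x. x \<in> \<xi>)"

definition ultrapower :: "'i filter \<Rightarrow> ('i \<Rightarrow> 'a::real_normed_vector) set normed_struct" where
  "ultrapower U = \<lparr>
     points = linf // ultra_rel U,
     vzero = ultra_class U (\<lambda>_. 0),
     vadd = (\<lambda>\<xi> \<eta>. ultra_class U (\<lambda>i. rep \<xi> i + rep \<eta> i)),
     vscale = (\<lambda>c \<xi>. ultra_class U (\<lambda>i. c *\<^sub>R rep \<xi> i)),
     vnorm = (\<lambda>\<xi>. Lim U (\<lambda>i. norm (rep \<xi> i)))\<rparr>"

definition ultra_set ::
  "'i filter \<Rightarrow> 'a::real_normed_vector set \<Rightarrow> ('i \<Rightarrow> 'a) set set" where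
  "ultra_set U A = {ultra_class U x | x. \<forall>i. x i \<in> A}"

definition ultra_embed :: "'i filter \<Rightarrow> 'a::real_normed_vector \<Rightarrow> ('i \<Rightarrow> 'a) set" where
  "ultra_embed U v = ultra_class U (\<lambda>_. v)"


subsection \<open>Well-definedness\<close>

lemma linf_add: "x \<in> linf \<Longrightarrow> y \<in> linf \<Longrightarrow> (\<lambda>i. x i + y i) \<in> linf"
  unfolding linf_def by (simp add: bounded_plus_comp)

lemma linf_scale: "x \<in> linf \<Longrightarrow> (\<lambda>i. c *\<^sub>R x i) \<in> linf"
  unfolding linf_def
  using bounded_scaling[of "range x" c] by (simp add: image_image)

lemma linf_const: "(\<lambda>_. v) \<in> linf"
  unfolding linf_def by simp

lemma equiv_ultra_rel: "equiv linf (ultra_rel U)"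
proof (rule equivI)
  show "ultra_rel U \<subseteq> linf \<times> linf" by (auto simp: ultra_rel_def)
  show "refl_on linf (ultra_rel U)" by (auto simp: refl_on_def ultra_rel_def)
  show "sym (ultra_rel U)" by (auto simp: sym_def ultra_rel_def norm_minus_commute)
  show "trans (ultra_rel U)"
  proof (rule transI)
    fix x y z assume xy: "(x, y) \<in> ultra_rel U" and yz: "(y, z) \<in> ultra_rel U"
    have "((\<lambda>i. norm (x i - y i) + norm (y i - z i)) \<longlongrightarrow> 0) U"
      using xy yz by (auto simp: ultra_rel_def intro: tendsto_add_zero)
    moreover have "norm (norm (x i - z i)) \<le> norm (x i - y i) + norm (y i - z i)" for i
      using norm_triangle_ineq[of "x i - y i" "y i - z i"] by simp
    ultimately have "((\<lambda>i. norm (x i - z i)) \<longlongrightarrow> 0) U"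
      by (intro Lim_null_comparison[of "\<lambda>i. norm (x i - z i)"] always_eventually) auto
    then show "(x, z) \<in> ultra_rel U" using xy yz by (auto simp: ultra_rel_def)
  qed
qed

lemma ultra_class_eq_iff:
  assumes "x \<in> linf" "y \<in> linf"
  shows "ultra_class U x = ultra_class U y \<longleftrightarrow> ((\<lambda>i. norm (x i - y i)) \<longlongrightarrow> 0) U"
  using eq_equiv_class_iff[OF equiv_ultra_rel assms, of U] assms
  by (simp add: ultra_class_def ultra_rel_def)

lemma rep_ultra_class:
  assumes "x \<in> linf"
  shows "rep (ultra_class U x) \<in> linf"
    and "((\<lambda>i. norm (x i - rep (ultra_class U x) i)) \<longlongrightarrow> 0) U"
proof -
  have "x \<in> ultra_class U x"
    using assms by (simp add: ultra_class_def ultra_rel_def)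
  then have "rep (ultra_class U x) \<in> ultra_class U x"
    unfolding rep_def by (rule someI[of "\<lambda>y. y \<in> ultra_class U x"])
  then show "rep (ultra_class U x) \<in> linf"
    and "((\<lambda>i. norm (x i - rep (ultra_class U x) i)) \<longlongrightarrow> 0) U"
    by (auto simp: ultra_class_def ultra_rel_def)
qed

lemma ultrapower_add:
  assumes "x \<in> linf" "y \<in> linf"
  shows "vadd (ultrapower U) (ultra_class U x) (ultra_class U y)
           = ultra_class U (\<lambda>i. x i + y i)"
proof -
  let ?x = "rep (ultra_class U x)" and ?y = "rep (ultra_class U y)"
  have "((\<lambda>i. (x i - ?x i) + (y i - ?y i)) \<longlongrightarrow> 0) U"
    using rep_ultra_class(2)[OF assms(1)] rep_ultra_class(2)[OF assms(2)]
    by (intro tendsto_add_zero) (simp_all add: tendsto_norm_zero_iff)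
  from tendsto_minus[OF this] have "((\<lambda>i. (?x i + ?y i) - (x i + y i)) \<longlongrightarrow> 0) U"
    by (simp add: algebra_simps)
  then have "ultra_class U (\<lambda>i. ?x i + ?y i) = ultra_class U (\<lambda>i. x i + y i)"
    by (subst ultra_class_eq_iff)
       (intro linf_add rep_ultra_class(1) assms, intro linf_add assms, rule tendsto_norm_zero)
  then show ?thesis by (simp add: ultrapower_def)
qed

lemma ultrapower_scale:
  assumes "x \<in> linf"
  shows "vscale (ultrapower U) c (ultra_class U x) = ultra_class U (\<lambda>i. c *\<^sub>R x i)"
proof -
  let ?x = "rep (ultra_class U x)"
  have "((\<lambda>i. (- c) *\<^sub>R (x i - ?x i)) \<longlongrightarrow> (- c) *\<^sub>R 0) U"
    using rep_ultra_class(2)[OF assms]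
    by (intro tendsto_scaleR tendsto_const) (simp add: tendsto_norm_zero_iff)
  then have "((\<lambda>i. c *\<^sub>R ?x i - c *\<^sub>R x i) \<longlongrightarrow> 0) U"
    by (simp add: algebra_simps)
  then have "ultra_class U (\<lambda>i. c *\<^sub>R ?x i) = ultra_class U (\<lambda>i. c *\<^sub>R x i)"
    by (subst ultra_class_eq_iff)
       (intro linf_scale rep_ultra_class(1) assms, intro linf_scale assms, rule tendsto_norm_zero)
  then show ?thesis by (simp add: ultrapower_def)
qed

lemma ultrafilter_tendsto_ex:
  fixes f :: "'i \<Rightarrow> real"
  assumes U: "ultrafilter U" and f: "bounded (range f)"
  shows "\<exists>l. (f \<longlongrightarrow> l) U"
proof -
  have "compact (closure (range f))" using f by simp
  moreover have "eventually (\<lambda>r. r \<in> closure (range f)) (filtermap f U)"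
    unfolding eventually_filtermap
    by (intro always_eventually allI subsetD[OF closure_subset] rangeI)
  moreover have "filtermap f U \<noteq> bot"
    using U by (simp add: ultrafilter_def filtermap_bot_iff)
  ultimately obtain l where l: "inf (nhds l) (filtermap f U) \<noteq> bot"
    unfolding compact_filter by meson
  have "eventually (\<lambda>i. f i \<in> S) U" if "open S" "l \<in> S" for S
  proof (rule ccontr)
    assume "\<not> eventually (\<lambda>i. f i \<in> S) U"
    then have "eventually (\<lambda>i. f i \<notin> S) U"
      using U[unfolded ultrafilter_def, THEN conjunct2, rule_format, of "f -` S"] by simp
    then have "eventually (\<lambda>r. r \<notin> S) (filtermap f U)"
      by (simp add: eventually_filtermap)
    moreover have "eventually (\<lambda>r. r \<in> S) (nhds l)"
      using that by (rule eventually_nhds_in_open)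
    ultimately have "eventually (\<lambda>r. False) (inf (nhds l) (filtermap f U))"
      unfolding eventually_inf
      by (intro exI[of _ "\<lambda>r. r \<in> S"] exI[of _ "\<lambda>r. r \<notin> S"]) auto
    with l show False by (simp add: eventually_False)
  qed
  then show ?thesis by (auto simp: tendsto_def)
qed

lemma ultrapower_norm:
  assumes U: "ultrafilter U" and x: "x \<in> linf"
  shows "((\<lambda>i. norm (x i)) \<longlongrightarrow> vnorm (ultrapower U) (ultra_class U x)) U"
proof -
  let ?x = "rep (ultra_class U x)"
  have nb: "\<not> trivial_limit U" using U by (simp add: ultrafilter_def)
  have "bounded (range (\<lambda>i. norm (x i)))"
    using x unfolding linf_def by (auto simp: bounded_iff)
  then obtain l where l: "((\<lambda>i. norm (x i)) \<longlongrightarrow> l) U"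
    using ultrafilter_tendsto_ex[OF U] by blast
  have "((\<lambda>i. norm (x i) - norm (?x i)) \<longlongrightarrow> 0) U"
    using rep_ultra_class(2)[OF x]
    by (rule Lim_null_comparison[rotated])
       (simp add: norm_triangle_ineq3)
  from tendsto_diff[OF l this] have "((\<lambda>i. norm (?x i)) \<longlongrightarrow> l) U" by simp
  with nb have "Lim U (\<lambda>i. norm (?x i)) = l" by (rule tendsto_Lim)
  with l show ?thesis by (simp add: ultrapower_def)
qed

lemma ultra_set_subset_points:
  assumes "bounded A"
  shows "ultra_set U A \<subseteq> points (ultrapower U)"
proof
  fix \<xi> assume "\<xi> \<in> ultra_set U A"
  then obtain x where x: "\<And>i. x i \<in> A" "\<xi> = ultra_class U x"
    by (auto simp: ultra_set_def)
  then have "range x \<subseteq> A" by blast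
  with assms have "x \<in> linf" unfolding linf_def by (simp add: bounded_subset)
  then show "\<xi> \<in> points (ultrapower U)"
    using x by (simp add: ultrapower_def ultra_class_def quotientI)
qed

lemma ultra_embed_in_ultra_set: "v \<in> A \<Longrightarrow> ultra_embed U v \<in> ultra_set U A"
  unfolding ultra_embed_def ultra_set_def by blast

end

theory Submission
  imports Defs
begin

text \<open>
  Strong extremality is a uniform \<open>\<epsilon>\<close>-\<open>\<delta>\<close> condition on pairs of points of the set, hence passes
  pointwise along \<open>U\<close> from \<open>C\<close> to its ultrapower. Conversely, countable incompleteness yields
  an index map \<open>'i \<Rightarrow> nat\<close> tending to infinity along \<open>U\<close>; composing sequences that
  violate strong extremality of \<open>x\<close> with it turns approximate midpoints into exact ones, so the
  image of \<open>x\<close> is not extreme.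
\<close>

text \<open>Stated for an arbitrary \<open>normed_struct\<close>, so that it applies both to
  \<open>type_space\<close> and to the ultrapower. There \<open>vnorm\<close> is merely some
  real-valued function, and its convergence to 0 controls only its absolute value; hence the
  bars.\<close>

lemma strongly_extreme_point_eps_delta:
  "strongly_extreme_point E D x \<longleftrightarrow> x \<in> D \<and>
     (\<forall>e>0. \<exists>d>0. \<forall>y\<in>D. \<forall>z\<in>D.
        \<bar>vnorm E (vdiff E x (vscale E (1/2) (vadd E y z)))\<bar> < d \<longrightarrow>
        \<bar>vnorm E (vdiff E y z)\<bar> < e)"
    (is "_ \<longleftrightarrow> x \<in> D \<and> (\<forall>e>0. \<exists>d>0. \<forall>y\<in>D. \<forall>z\<in>D. \<bar>?m y z\<bar> < d \<longrightarrow> \<bar>?r y z\<bar> < e)")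
proof (intro iffI conjI allI impI)
  assume S: "strongly_extreme_point E D x"
  then show "x \<in> D" by (simp add: strongly_extreme_point_def)
  fix e :: real
  assume "e > 0"
  show "\<exists>d>0. \<forall>y\<in>D. \<forall>z\<in>D. \<bar>?m y z\<bar> < d \<longrightarrow> \<bar>?r y z\<bar> < e"
  proof (rule ccontr)
    assume neg: "\<not> ?thesis"
    \<comment> \<open>Choosing \<open>d\<close> as 1/(n+1) in the negated condition gives two
      sequences whose midpoints approach \<open>x\<close> while the gap stays at least
      \<open>e\<close>.\<close>
    have "\<exists>y z. y \<in> D \<and> z \<in> D \<and> \<bar>?m y z\<bar> < inverse (real (Suc n)) \<and> \<bar>?r y z\<bar> \<ge> e" for n
    proof -
      have "inverse (real (Suc n)) > 0" by simp
      with neg show ?thesis by (meson not_less)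
    qed
    then obtain y z where yz: "\<And>n. y n \<in> D" "\<And>n. z n \<in> D"
      and m: "\<And>n. \<bar>?m (y n) (z n)\<bar> < inverse (real (Suc n))"
      and r: "\<And>n. \<bar>?r (y n) (z n)\<bar> \<ge> e"
      by metis
    have "(\<lambda>n. ?m (y n) (z n)) \<longlonglongrightarrow> 0"
      by (rule Lim_null_comparison[OF _ LIMSEQ_inverse_real_of_nat])
         (use m in \<open>auto intro: always_eventually less_imp_le\<close>)
    with S yz have "(\<lambda>n. ?r (y n) (z n)) \<longlonglongrightarrow> 0"
      by (simp add: strongly_extreme_point_def)
    from tendstoD[OF this \<open>e > 0\<close>] have "eventually (\<lambda>n. \<bar>?r (y n) (z n)\<bar> < e) sequentially"
      by (simp add: dist_real_def)
    with r show False
      by (simp add: not_less[symmetric])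
  qed
next
  assume *: "x \<in> D \<and> (\<forall>e>0. \<exists>d>0. \<forall>y\<in>D. \<forall>z\<in>D. \<bar>?m y z\<bar> < d \<longrightarrow> \<bar>?r y z\<bar> < e)"
  have "(\<lambda>n. ?r (y n) (z n)) \<longlonglongrightarrow> 0"
    if y: "\<forall>n. y n \<in> D" and z: "\<forall>n. z n \<in> D" and lim: "(\<lambda>n. ?m (y n) (z n)) \<longlonglongrightarrow> 0" for y z
  proof (rule tendstoI)
    fix e :: real
    assume "e > 0"
    with * obtain d where "d > 0" and d: "\<forall>y\<in>D. \<forall>z\<in>D. \<bar>?m y z\<bar> < d \<longrightarrow> \<bar>?r y z\<bar> < e"
      by blast
    from tendstoD[OF lim \<open>d > 0\<close>] have "eventually (\<lambda>n. \<bar>?m (y n) (z n)\<bar> < d) sequentially"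
      by (simp add: dist_real_def)
    then show "eventually (\<lambda>n. dist (?r (y n) (z n)) 0 < e) sequentially"
      by eventually_elim (use y z d in \<open>simp add: dist_real_def\<close>)
  qed
  with * show "strongly_extreme_point E D x"
    by (simp add: strongly_extreme_point_def)
qed

lemma bounded_imp_linf: "bounded C \<Longrightarrow> (\<And>i. y i \<in> C) \<Longrightarrow> y \<in> linf"
  unfolding linf_def by (auto intro: bounded_subset)

lemma linf_diff: "x \<in> linf \<Longrightarrow> y \<in> linf \<Longrightarrow> (\<lambda>i. x i - y i) \<in> linf"
  unfolding linf_def by (simp add: bounded_minus_comp)

lemma ultrapower_diff:
  assumes "x \<in> linf" "y \<in> linf"
  shows "vdiff (ultrapower U) (ultra_class U x) (ultra_class U y) = ultra_class U (\<lambda>i. x i - y i)"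
  using ultrapower_add[OF assms(1) linf_scale[OF assms(2), of "-1"]]
  by (simp add: vdiff_def ultrapower_scale[OF assms(2)])

lemma ultrapower_norm_diff:
  assumes "ultrafilter U" "x \<in> linf" "y \<in> linf"
  shows "((\<lambda>i. norm (x i - y i)) \<longlongrightarrow>
           vnorm (ultrapower U) (vdiff (ultrapower U) (ultra_class U x) (ultra_class U y))) U"
  using ultrapower_norm[OF assms(1) linf_diff[OF assms(2,3)]]
  by (simp add: ultrapower_diff assms)

text \<open>This norm is the limit along \<open>U\<close> of the pointwise distances, and limits
  along \<open>U\<close> are unique because \<open>U\<close> is proper. It turns vanishing norms
  into equality of classes.\<close>

lemma ultrapower_norm_diff_eq_0_iff:
  assumes U: "ultrafilter U" and xy: "x \<in> linf" "y \<in> linf"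
  shows "vnorm (ultrapower U) (vdiff (ultrapower U) (ultra_class U x) (ultra_class U y)) = 0 \<longleftrightarrow>
           ultra_class U x = ultra_class U y"
  using ultrapower_norm_diff[OF U xy] U
  by (auto simp: ultra_class_eq_iff[OF xy] ultrafilter_def intro: tendsto_unique)

lemma ultrapower_convex_combination:
  assumes "x \<in> linf" "y \<in> linf"
  shows "vadd (ultrapower U) (vscale (ultrapower U) s (ultra_class U x))
             (vscale (ultrapower U) t (ultra_class U y)) =
           ultra_class U (\<lambda>i. s *\<^sub>R x i + t *\<^sub>R y i)"
  using assms by (simp add: ultrapower_scale ultrapower_add linf_scale)

lemma ultrapower_scale_add:
  assumes "x \<in> linf" "y \<in> linf"
  shows "vscale (ultrapower U) s (vadd (ultrapower U) (ultra_class U x) (ultra_class U y)) =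
           ultra_class U (\<lambda>i. s *\<^sub>R (x i + y i))"
  using assms by (simp add: ultrapower_scale ultrapower_add linf_add)

text \<open>Send \<open>i\<close> to the first \<open>n\<close> with \<open>i\<close> outside
  \<open>J n\<close>, which exists because the \<open>J n\<close> have empty intersection. Its value
  is at least \<open>n\<close> on the intersection of \<open>J 0\<close>, ...,
  \<open>J (n-1)\<close>, a finite intersection of members of \<open>U\<close>.\<close>

lemma countably_incomplete_filterlim_at_top:
  assumes "countably_incomplete_ultrafilter U"
  obtains f :: "'i \<Rightarrow> nat" where "filterlim f at_top (U :: 'i filter)"
proof -
  obtain J :: "nat \<Rightarrow> 'i set" where J: "\<And>n. eventually (\<lambda>i. i \<in> J n) U" "(\<Inter>n. J n) = {}"
    using assms by (auto simp: countably_incomplete_ultrafilter_def)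
  define f where "f i = (LEAST n. i \<notin> J n)" for i
  have "\<exists>n. i \<notin> J n" for i using J(2) by blast
  then have f: "i \<notin> J (f i)" for i unfolding f_def by (rule LeastI_ex)
  have "eventually (\<lambda>i. n \<le> f i) U" for n
  proof -
    have "eventually (\<lambda>i. \<forall>k\<in>{..<n}. i \<in> J k) U"
      by (simp add: eventually_ball_finite_distrib J(1))
    then show ?thesis
      by eventually_elim (use f not_less in blast)
  qed
  then have "filterlim f at_top U" by (simp add: filterlim_at_top)
  then show thesis by (rule that)
qed

text \<open>Constant sequences show that a strongly extreme point is not the midpoint of two
  distinct points of the set. An arbitrary proper convex combination is reduced to a midpoint by
  passing, index by index, to a subsegment centred at it, whose ends lie in \<open>C\<close> by
  convexity.\<close>

lemma strongly_extreme_imp_extreme_ultrapower: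
  assumes U: "ultrafilter U" and C: "bounded C" "convex C"
    and S: "strongly_extreme_point (ultrapower U) (ultra_set U C) \<xi>"
  shows "extreme_point (ultrapower U) (ultra_set U C) \<xi>"
proof -
  have "\<alpha> = \<beta>" if \<alpha>: "\<alpha> \<in> ultra_set U C" and \<beta>: "\<beta> \<in> ultra_set U C" and t: "0 < t" "t < 1"
    and eq: "\<xi> = vadd (ultrapower U) (vscale (ultrapower U) (1 - t) \<alpha>) (vscale (ultrapower U) t \<beta>)"
    for \<alpha> \<beta> t
  proof -
    obtain a b where ab: "\<alpha> = ultra_class U a" "\<beta> = ultra_class U b"
      and aC: "\<And>i. a i \<in> C" and bC: "\<And>i. b i \<in> C"
      using \<alpha> \<beta> by (auto simp: ultra_set_def)
    have lin: "a \<in> linf" "b \<in> linf"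
      using aC bC C(1) by (auto intro: bounded_imp_linf)
    define w where "w i = (1 - t) *\<^sub>R a i + t *\<^sub>R b i" for i
    have w: "w \<in> linf" unfolding w_def by (intro linf_add linf_scale lin)
    have \<xi>: "\<xi> = ultra_class U w"
      unfolding eq ab w_def by (rule ultrapower_convex_combination[OF lin])
    \<comment> \<open>In the segment's parameter, \<open>s\<close> is the distance from
      \<open>t\<close> to the nearer end of [0, 1], so \<open>t - s\<close> and \<open>t + s\<close>
      both stay in [0, 1].\<close>
    define s where "s = min t (1 - t)"
    have s: "0 < s" "s \<le> t" "s \<le> 1 - t" using t by (auto simp: s_def)
    \<comment> \<open>The largest segment in direction \<open>b - a\<close> centred at \<open>w\<close> that stays between \<open>a\<close> and \<open>b\<close>.\<close>
    define y where "y i = (1 - (t - s)) *\<^sub>R a i + (t - s) *\<^sub>R b i" for i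
    define z where "z i = (1 - (t + s)) *\<^sub>R a i + (t + s) *\<^sub>R b i" for i
    have yC: "y i \<in> C" and zC: "z i \<in> C" for i
      unfolding y_def z_def
      by (rule convexD[OF C(2) aC bC]; use s t in simp)+
    have yz: "y \<in> linf" "z \<in> linf"
      using yC zC C(1) by (auto intro: bounded_imp_linf)
    have "y i + z i = w i + w i" for i
      by (simp add: y_def z_def w_def algebra_simps)
    then have mid: "(\<lambda>i. (1/2) *\<^sub>R (y i + z i)) = w"
      by simp
    have "ultra_class U y \<in> ultra_set U C" "ultra_class U z \<in> ultra_set U C"
      using yC zC by (auto simp: ultra_set_def)
    moreover have "vnorm (ultrapower U) (vdiff (ultrapower U) \<xi> (vscale (ultrapower U) (1/2)
        (vadd (ultrapower U) (ultra_class U y) (ultra_class U z)))) = 0"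
      unfolding ultrapower_scale_add[OF yz] mid \<xi> by (simp add: ultrapower_norm_diff_eq_0_iff U w)
    \<comment> \<open>For constant sequences the midpoint error is identically 0, and the conclusion
      says that a constant tends to 0, so it is 0.\<close>
    ultimately have "(\<lambda>n::nat. vnorm (ultrapower U)
        (vdiff (ultrapower U) (ultra_class U y) (ultra_class U z))) \<longlonglongrightarrow> 0"
      using S[unfolded strongly_extreme_point_def, THEN conjunct2, rule_format,
          of "\<lambda>_. ultra_class U y" "\<lambda>_. ultra_class U z"] by simp
    then have "ultra_class U y = ultra_class U z"
      by (simp add: LIMSEQ_const_iff ultrapower_norm_diff_eq_0_iff U yz)
    then have lim: "((\<lambda>i. norm (y i - z i)) \<longlongrightarrow> 0) U"
      by (simp add: ultra_class_eq_iff yz)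
    \<comment> \<open>The subsegment is the original one shrunk by the factor
      \<open>2 * s > 0\<close>, so its collapse along \<open>U\<close> forces that of
      \<open>a i - b i\<close>.\<close>
    have "y i - z i = s *\<^sub>R (a i - b i) + s *\<^sub>R (a i - b i)" for i
      by (simp add: y_def z_def algebra_simps)
    then have "y i - z i = (2 * s) *\<^sub>R (a i - b i)" for i
      by (simp flip: scaleR_add_left)
    then have "norm (a i - b i) = norm (y i - z i) / (2 * s)" for i
      using s by simp
    with tendsto_divide_zero[OF lim, of "2 * s"] have "((\<lambda>i. norm (a i - b i)) \<longlongrightarrow> 0) U"
      by simp
    then show ?thesis by (simp add: ab ultra_class_eq_iff lin)
  qed
  then show ?thesis
    using S unfolding extreme_point_def strongly_extreme_point_def by blast
qed

lemma extreme_ultrapower_imp_strongly_extreme: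
  assumes U: "countably_incomplete_ultrafilter U" and C: "bounded C" and x: "x \<in> C"
    and E: "extreme_point (ultrapower U) (ultra_set U C) (ultra_embed U x)"
  shows "strongly_extreme_point type_space C x"
proof (rule ccontr)
  assume "\<not> ?thesis"
  with x obtain e where "e > 0" and e: "\<And>d. d > 0 \<Longrightarrow>
      \<exists>y\<in>C. \<exists>z\<in>C. norm (x - (1/2) *\<^sub>R (y + z)) < d \<and> e \<le> norm (y - z)"
    by (auto simp: strongly_extreme_point_eps_delta type_space_def vdiff_def not_less)
      (metis not_less)
  have "\<exists>y z. y \<in> C \<and> z \<in> C \<and> norm (x - (1/2) *\<^sub>R (y + z)) < inverse (real (Suc n)) \<and>
      e \<le> norm (y - z)" for n
    using e[of "inverse (real (Suc n))"] by auto
  then obtain y z where yC: "\<And>n. y n \<in> C" and zC: "\<And>n. z n \<in> C"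
    and m: "\<And>n. norm (x - (1/2) *\<^sub>R (y n + z n)) < inverse (real (Suc n))"
    and r: "\<And>n. e \<le> norm (y n - z n)"
    by metis
  have m0: "(\<lambda>n. norm (x - (1/2) *\<^sub>R (y n + z n))) \<longlonglongrightarrow> 0"
    by (rule Lim_null_comparison[OF _ LIMSEQ_inverse_real_of_nat])
       (use m in \<open>auto intro: always_eventually less_imp_le\<close>)
  obtain f :: "_ \<Rightarrow> nat" where f: "filterlim f at_top U"
    using countably_incomplete_filterlim_at_top[OF U] .
  have bot: "U \<noteq> bot"
    using U by (simp add: countably_incomplete_ultrafilter_def free_ultrafilter_def ultrafilter_def)
  let ?Y = "\<lambda>i. y (f i)" and ?Z = "\<lambda>i. z (f i)"
  have lin: "?Y \<in> linf" "?Z \<in> linf"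
    using yC zC C by (auto intro: bounded_imp_linf)
  have mem: "ultra_class U ?Y \<in> ultra_set U C" "ultra_class U ?Z \<in> ultra_set U C"
    using yC zC unfolding ultra_set_def by blast+
  \<comment> \<open>Composing \<open>m0\<close> with \<open>f\<close> makes the midpoint error
    vanish along \<open>U\<close>, so in the ultrapower the midpoint is exact. The weight is written
    \<open>1 - 1/2\<close> to match \<open>extreme_point\<close> at t = 1/2.\<close>
  have "((\<lambda>i. norm (x - ((1 - 1/2) *\<^sub>R ?Y i + (1/2) *\<^sub>R ?Z i))) \<longlongrightarrow> 0) U"
    using filterlim_compose[OF m0 f] by (simp add: scaleR_add_right)
  then have "ultra_embed U x = vadd (ultrapower U) (vscale (ultrapower U) (1 - 1/2) (ultra_class U ?Y))
      (vscale (ultrapower U) (1/2) (ultra_class U ?Z))"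
    unfolding ultrapower_convex_combination[OF lin] ultra_embed_def
    by (subst ultra_class_eq_iff) (intro linf_const linf_add linf_scale lin | assumption)+
  with E mem have "ultra_class U ?Y = ultra_class U ?Z"
    unfolding extreme_point_def by (metis half_gt_zero_iff zero_less_one field_sum_of_halves
        less_add_same_cancel1)
  then have "((\<lambda>i. norm (?Y i - ?Z i)) \<longlongrightarrow> 0) U"
    by (simp add: ultra_class_eq_iff lin)
  \<comment> \<open>The uniform gap \<open>e\<close> passes to the limit along the proper filter
    \<open>U\<close>.\<close>
  then have "e \<le> 0"
    by (rule tendsto_lowerbound) (use r bot in auto)
  with \<open>e > 0\<close> show False by simp
qed

lemma strongly_extreme_imp_strongly_extreme_ultrapower:
  assumes U: "ultrafilter U" and C: "bounded C"
    and S: "strongly_extreme_point type_space C x"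
  shows "strongly_extreme_point (ultrapower U) (ultra_set U C) (ultra_embed U x)"
  unfolding strongly_extreme_point_eps_delta
proof (intro conjI allI impI)
  have bot: "U \<noteq> bot" using U by (simp add: ultrafilter_def)
  show "ultra_embed U x \<in> ultra_set U C"
    using S by (simp add: strongly_extreme_point_def ultra_embed_in_ultra_set)
  fix e :: real
  assume "e > 0"
  \<comment> \<open>Passing to the limit along \<open>U\<close> weakens a strict bound to a weak
    one; starting from \<open>e / 2\<close> leaves the final bound by \<open>e\<close>
    strict.\<close>
  with S[unfolded strongly_extreme_point_eps_delta, THEN conjunct2, rule_format, of "e / 2"]
  obtain d where "d > 0" and d: "\<And>y z. y \<in> C \<Longrightarrow> z \<in> C \<Longrightarrow>
      norm (x - (1/2) *\<^sub>R (y + z)) < d \<Longrightarrow> norm (y - z) < e / 2"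
    by (auto simp: type_space_def vdiff_def)
  have "\<bar>vnorm (ultrapower U) (vdiff (ultrapower U) \<eta> \<zeta>)\<bar> < e"
    if mem: "\<eta> \<in> ultra_set U C" "\<zeta> \<in> ultra_set U C"
      and mid: "\<bar>vnorm (ultrapower U) (vdiff (ultrapower U) (ultra_embed U x)
                 (vscale (ultrapower U) (1/2) (vadd (ultrapower U) \<eta> \<zeta>)))\<bar> < d" for \<eta> \<zeta>
  proof -
    obtain y z where yz: "\<eta> = ultra_class U y" "\<zeta> = ultra_class U z"
      and yC: "\<And>i. y i \<in> C" and zC: "\<And>i. z i \<in> C"
      using mem by (auto simp: ultra_set_def)
    have lin: "y \<in> linf" "z \<in> linf"
      using yC zC C by (auto intro: bounded_imp_linf)
    have "(\<lambda>i. (1/2) *\<^sub>R (y i + z i)) \<in> linf" by (intro linf_scale linf_add lin)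
    \<comment> \<open>A strict upper bound on the limit already holds for the terms on a set
      belonging to \<open>U\<close>, which is where the choice of \<open>d\<close> applies
      pointwise.\<close>
    then have "eventually (\<lambda>i. norm (x - (1/2) *\<^sub>R (y i + z i)) < d) U"
      using mid unfolding yz ultra_embed_def ultrapower_scale_add[OF lin]
      by (intro order_tendstoD(2)[OF ultrapower_norm_diff[OF U linf_const]]) linarith+
    then have ev: "eventually (\<lambda>i. norm (y i - z i) \<le> e / 2) U"
      by eventually_elim (use d yC zC in \<open>blast intro: less_imp_le\<close>)
    note lim = ultrapower_norm_diff[OF U lin]
    have "vnorm (ultrapower U) (vdiff (ultrapower U) \<eta> \<zeta>) \<le> e / 2"
      unfolding yz by (rule tendsto_upperbound[OF lim ev bot])
    moreover have "0 \<le> vnorm (ultrapower U) (vdiff (ultrapower U) \<eta> \<zeta>)"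
      unfolding yz by (rule tendsto_lowerbound[OF lim _ bot]) simp
    ultimately show ?thesis using \<open>e > 0\<close> by simp
  qed
  with \<open>d > 0\<close> show "\<exists>d>0. \<forall>\<eta>\<in>ultra_set U C. \<forall>\<zeta>\<in>ultra_set U C.
      \<bar>vnorm (ultrapower U) (vdiff (ultrapower U) (ultra_embed U x)
         (vscale (ultrapower U) (1/2) (vadd (ultrapower U) \<eta> \<zeta>)))\<bar> < d \<longrightarrow>
      \<bar>vnorm (ultrapower U) (vdiff (ultrapower U) \<eta> \<zeta>)\<bar> < e"
    by blast
qed

theorem theorem3p7:
  fixes C :: "'a::banach set" and x :: 'a and U :: "'i filter"
  assumes "infinite (UNIV :: 'i set)"
    and "countably_incomplete_ultrafilter U"
    and "bounded C" and "convex C"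
    and "x \<in> C"
  shows "(strongly_extreme_point (ultrapower U) (ultra_set U C) (ultra_embed U x)
            \<longleftrightarrow> extreme_point (ultrapower U) (ultra_set U C) (ultra_embed U x))
       \<and> (extreme_point (ultrapower U) (ultra_set U C) (ultra_embed U x)
            \<longleftrightarrow> strongly_extreme_point type_space C x)"
proof -
  have "ultrafilter U"
    using assms(2) by (simp add: countably_incomplete_ultrafilter_def free_ultrafilter_def)
  \<comment> \<open>The three implications form the cycle (i) to (ii) to (iii) to (i).\<close>
  then show ?thesis
    using strongly_extreme_imp_extreme_ultrapower[of U C "ultra_embed U x"]
      extreme_ultrapower_imp_strongly_extreme[of U C x]
      strongly_extreme_imp_strongly_extreme_ultrapower[of U C x] assms(2-5)
    by argo
qed

end
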